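(* If $G$ is a residually finite group, then $\operatorname{Conj}(G)$ and $\operatorname{Core}(G)$ are both residually finite quandles.
   Context: A quandle is a non-empty set $X$ with a binary operation $*$ such that: (1) $x*x=x$ for all $x\in X$; (2) for all $x,y\in X$ there is a unique $z\in X$ with $x=z*y$; (3) $(x*y)*z=(x*z)*(y*z)$ for all $x,y,z\in X$. A quandle homomorphism is a map $f$ with $f(x*y)=f(x)*f(y)$. A quandle $X$ is residually finite if for all $x,y\in X$ with $x\neq y$ there exist a finite quandle $F$ and a quandle homomorphism $\phi:X\to F$ with $\phi(x)\neq\phi(y)$. For a group $G$, $\operatorname{Conj}(G)$ is the set $G$ with the quandle operation $a*b=b^{-1}ab$, and $\operatorname{Core}(G)$ is the set $G$ with the quandle operation $a*b=ba^{-1}b$. A group $G$ is residually finite if for each $g\in G$, $g\ne1$, there are a finite group $F$ and a group homomorphism $\phi:G\to F$ with $\phi(g)\neq 1$. *)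

theory Defs
  imports "HOL-Algebra.Group"
begin

record 'a quandle_struct = "'a partial_object" +
  qop :: "'a \<Rightarrow> 'a \<Rightarrow> 'a" (infixl "\<star>\<index>" 70)

locale quandle =
  fixes X :: "('a, 'b) quandle_struct_scheme" (structure)
  assumes nonempty: "carrier X \<noteq> {}"
    and closed: "\<lbrakk>x \<in> carrier X; y \<in> carrier X\<rbrakk> \<Longrightarrow> x \<star> y \<in> carrier X"
    and idem: "x \<in> carrier X \<Longrightarrow> x \<star> x = x"
    and right_div: "\<lbrakk>x \<in> carrier X; y \<in> carrier X\<rbrakk> \<Longrightarrow> \<exists>!z. z \<in> carrier X \<and> x = z \<star> y"
    and right_distrib: "\<lbrakk>x \<in> carrier X; y \<in> carrier X; z \<in> carrier X\<rbrakk>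
           \<Longrightarrow> (x \<star> y) \<star> z = (x \<star> z) \<star> (y \<star> z)"

definition quandle_hom ::
    "('a, 'c) quandle_struct_scheme \<Rightarrow> ('b, 'd) quandle_struct_scheme \<Rightarrow> ('a \<Rightarrow> 'b) set" where
  "quandle_hom X Y = {f. f \<in> carrier X \<rightarrow> carrier Y \<and>
     (\<forall>x\<in>carrier X. \<forall>y\<in>carrier X. f (x \<star>\<^bsub>X\<^esub> y) = f x \<star>\<^bsub>Y\<^esub> f y)}"

text \<open>
  HOL formulas cannot quantify over types, so the finite targets in the two notions of residual
  finiteness have carriers consisting of natural numbers. Every finite structure is isomorphic to
  one of these; \<open>finite_group_target_nat\<close> and \<open>finite_quandle_target_nat\<close> below
  confirm that nothing is lost.
\<close>

definition residually_finite_group :: "('a, 'b) monoid_scheme \<Rightarrow> bool" where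
  "residually_finite_group G \<longleftrightarrow> group G \<and>
     (\<forall>g\<in>carrier G. g \<noteq> \<one>\<^bsub>G\<^esub> \<longrightarrow>
        (\<exists>(F :: nat monoid) \<phi>. group F \<and> finite (carrier F) \<and> \<phi> \<in> hom G F \<and> \<phi> g \<noteq> \<one>\<^bsub>F\<^esub>))"

definition residually_finite_quandle :: "('a, 'b) quandle_struct_scheme \<Rightarrow> bool" where
  "residually_finite_quandle X \<longleftrightarrow> quandle X \<and>
     (\<forall>x\<in>carrier X. \<forall>y\<in>carrier X. x \<noteq> y \<longrightarrow>
        (\<exists>(F :: nat quandle_struct) \<phi>.
           quandle F \<and> finite (carrier F) \<and> \<phi> \<in> quandle_hom X F \<and> \<phi> x \<noteq> \<phi> y))"

definition Conj :: "('a, 'b) monoid_scheme \<Rightarrow> 'a quandle_struct" where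
  "Conj G = \<lparr>carrier = carrier G, qop = (\<lambda>a b. inv\<^bsub>G\<^esub> b \<otimes>\<^bsub>G\<^esub> a \<otimes>\<^bsub>G\<^esub> b)\<rparr>"

definition Core :: "('a, 'b) monoid_scheme \<Rightarrow> 'a quandle_struct" where
  "Core G = \<lparr>carrier = carrier G, qop = (\<lambda>a b. b \<otimes>\<^bsub>G\<^esub> inv\<^bsub>G\<^esub> a \<otimes>\<^bsub>G\<^esub> b)\<rparr>"

lemma finite_group_target_nat:
  fixes G :: "('a, 'c) monoid_scheme" and F :: "('b, 'd) monoid_scheme"
  assumes "group F" "finite (carrier F)" "\<phi> \<in> hom G F" "g \<in> carrier G" "\<phi> g \<noteq> \<one>\<^bsub>F\<^esub>"
  shows "\<exists>(N :: nat monoid) \<psi>. group N \<and> finite (carrier N) \<and> \<psi> \<in> hom G N \<and> \<psi> g \<noteq> \<one>\<^bsub>N\<^esub>"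
proof -
  interpret F: group F by fact
  obtain h :: "'b \<Rightarrow> nat" where h: "inj_on h (carrier F)"
    using finite_imp_inj_to_nat_seg[OF assms(2)] by blast
  define k where "k = inv_into (carrier F) h"
  have kh [simp]: "k (h x) = x" if "x \<in> carrier F" for x
    using that h by (simp add: k_def)
  define N :: "nat monoid" where
    "N = \<lparr>carrier = h ` carrier F, mult = (\<lambda>x y. h (k x \<otimes>\<^bsub>F\<^esub> k y)), one = h \<one>\<^bsub>F\<^esub>\<rparr>"
  have N: "group N"
  proof (rule groupI)
    fix x assume "x \<in> carrier N"
    then obtain u where u: "u \<in> carrier F" "x = h u" by (auto simp: N_def)
    show "\<exists>y\<in>carrier N. y \<otimes>\<^bsub>N\<^esub> x = \<one>\<^bsub>N\<^esub>"
      by (rule bexI[of _ "h (inv\<^bsub>F\<^esub> u)"]) (use u in \<open>auto simp: N_def\<close>)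
  qed (auto simp: N_def F.m_assoc)
  have \<phi>: "\<phi> x \<in> carrier F" if "x \<in> carrier G" for x
    using assms(3) that by (auto simp: hom_def)
  have "(h \<circ> \<phi>) \<in> hom G N"
    using assms(3) by (auto simp: hom_def N_def \<phi>)
  moreover have "(h \<circ> \<phi>) g \<noteq> \<one>\<^bsub>N\<^esub>"
    using assms(5) \<phi>[OF assms(4)] h by (auto simp: N_def inj_on_def)
  moreover have "finite (carrier N)" using assms(2) by (simp add: N_def)
  ultimately show ?thesis using N by blast
qed

lemma finite_quandle_target_nat:
  fixes X :: "('a, 'c) quandle_struct_scheme" and F :: "('b, 'd) quandle_struct_scheme"
  assumes "quandle F" "finite (carrier F)" "\<phi> \<in> quandle_hom X F"
    and "x \<in> carrier X" "y \<in> carrier X" "\<phi> x \<noteq> \<phi> y"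
  shows "\<exists>(N :: nat quandle_struct) \<psi>.
    quandle N \<and> finite (carrier N) \<and> \<psi> \<in> quandle_hom X N \<and> \<psi> x \<noteq> \<psi> y"
proof -
  interpret F: quandle F by fact
  obtain h :: "'b \<Rightarrow> nat" where h: "inj_on h (carrier F)"
    using finite_imp_inj_to_nat_seg[OF assms(2)] by blast
  define k where "k = inv_into (carrier F) h"
  have kh [simp]: "k (h x) = x" if "x \<in> carrier F" for x
    using that h by (simp add: k_def)
  define N :: "nat quandle_struct" where
    "N = \<lparr>carrier = h ` carrier F, qop = (\<lambda>x y. h (k x \<star>\<^bsub>F\<^esub> k y))\<rparr>"
  have N: "quandle N"
  proof
    fix x y assume "x \<in> carrier N" "y \<in> carrier N"
    then obtain u v where u: "u \<in> carrier F" "x = h u" "v \<in> carrier F" "y = h v"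
      by (auto simp: N_def)
    obtain w where w: "w \<in> carrier F" "u = w \<star>\<^bsub>F\<^esub> v"
      "\<And>w'. w' \<in> carrier F \<Longrightarrow> u = w' \<star>\<^bsub>F\<^esub> v \<Longrightarrow> w' = w"
      using F.right_div[OF u(1,3)] by blast
    show "\<exists>!z. z \<in> carrier N \<and> x = z \<star>\<^bsub>N\<^esub> y"
    proof (rule ex1I[of _ "h w"])
      show "h w \<in> carrier N \<and> x = h w \<star>\<^bsub>N\<^esub> y" using u w(1,2) by (auto simp: N_def)
      fix z assume z: "z \<in> carrier N \<and> x = z \<star>\<^bsub>N\<^esub> y"
      then obtain w' where w': "w' \<in> carrier F" "z = h w'" by (auto simp: N_def)
      with z u have "h u = h (w' \<star>\<^bsub>F\<^esub> v)" by (simp add: N_def)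
      hence "u = w' \<star>\<^bsub>F\<^esub> v" using h u w' F.closed by (auto dest: inj_onD)
      thus "z = h w" using w(3) w' by blast
    qed
  next
    fix x y z assume "x \<in> carrier N" "y \<in> carrier N" "z \<in> carrier N"
    thus "(x \<star>\<^bsub>N\<^esub> y) \<star>\<^bsub>N\<^esub> z = (x \<star>\<^bsub>N\<^esub> z) \<star>\<^bsub>N\<^esub> (y \<star>\<^bsub>N\<^esub> z)"
      by (auto simp: N_def F.closed F.right_distrib[symmetric])
  qed (auto simp: N_def F.nonempty F.closed F.idem)
  have \<phi>: "\<phi> x \<in> carrier F" if "x \<in> carrier X" for x
    using assms(3) that by (auto simp: quandle_hom_def)
  have "(h \<circ> \<phi>) \<in> quandle_hom X N"
    using assms(3) by (auto simp: quandle_hom_def N_def \<phi>)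
  moreover have "(h \<circ> \<phi>) x \<noteq> (h \<circ> \<phi>) y"
    using assms(6) \<phi>[OF assms(4)] \<phi>[OF assms(5)] h by (auto simp: inj_on_def)
  moreover have "finite (carrier N)" using assms(2) by (simp add: N_def)
  ultimately show ?thesis using N by blast
qed

end

theory Submission
  imports Defs
begin

text \<open>\<open>Conj\<close> and \<open>Core\<close> are functors that keep the underlying set
  and map: their operations are words in products and inverses, so a group homomorphism is also a
  homomorphism of the associated quandles (\<open>quandle_hom_Conj\<close>,
  \<open>quandle_hom_Core\<close>), and a finite group yields finite quandles. It remains to
  separate two points rather than one element from the identity, which
  \<open>residually_finite_group_separates\<close> achieves by passing to a quotient x y^-1.\<close>

context group
begin

lemma inv_mult_cancel_left:
  "\<lbrakk>x \<in> carrier G; y \<in> carrier G\<rbrakk> \<Longrightarrow> inv x \<otimes> (x \<otimes> y) = y"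
  by (simp add: m_assoc[symmetric])

lemma mult_inv_cancel_left:
  "\<lbrakk>x \<in> carrier G; y \<in> carrier G\<rbrakk> \<Longrightarrow> x \<otimes> (inv x \<otimes> y) = y"
  by (simp add: m_assoc[symmetric])

text \<open>Rewriting to a normal form of group words: brackets go right, inverses move to the
  letters. The two cancellation rules remove an inverse pair followed by a tail, where
  \<open>l_inv\<close> and \<open>r_inv\<close> no longer match.\<close>

lemmas word_simps = m_assoc inv_mult_group inv_mult_cancel_left mult_inv_cancel_left

lemma quandle_Conj: "quandle (Conj G)"
proof
  fix x y assume "x \<in> carrier (Conj G)" "y \<in> carrier (Conj G)"
  then have xy: "x \<in> carrier G" "y \<in> carrier G" by (simp_all add: Conj_def)
  show "\<exists>!z. z \<in> carrier (Conj G) \<and> x = z \<star>\<^bsub>Conj G\<^esub> y"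
    \<comment> \<open>The witness solves x = y^-1 z y for z.\<close>
    by (rule ex1I[of _ "y \<otimes> x \<otimes> inv y"]) (use xy in \<open>auto simp: Conj_def word_simps\<close>)
qed (auto simp: Conj_def word_simps)

lemma quandle_Core: "quandle (Core G)"
proof
  fix x y assume "x \<in> carrier (Core G)" "y \<in> carrier (Core G)"
  then have xy: "x \<in> carrier G" "y \<in> carrier G" by (simp_all add: Core_def)
  show "\<exists>!z. z \<in> carrier (Core G) \<and> x = z \<star>\<^bsub>Core G\<^esub> y"
    \<comment> \<open>Solving x = y z^-1 y gives z = y x^-1 y, which is the \<open>Core\<close>
      product of x and y: right translation by y is an involution.\<close>
    by (rule ex1I[of _ "y \<otimes> inv x \<otimes> y"]) (use xy in \<open>auto simp: Core_def word_simps\<close>)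
qed (auto simp: Core_def word_simps)

end

lemma (in group_hom) quandle_hom_Conj: "h \<in> quandle_hom (Conj G) (Conj H)"
  by (auto simp: quandle_hom_def Conj_def)

lemma (in group_hom) quandle_hom_Core: "h \<in> quandle_hom (Core G) (Core H)"
  by (auto simp: quandle_hom_def Core_def)

text \<open>Distinct x and y have x y^-1 different from the identity, and a homomorphism that does
  not kill x y^-1 cannot identify x and y.\<close>

lemma residually_finite_group_separates:
  fixes G :: "('a, 'b) monoid_scheme"
  assumes "residually_finite_group G" "x \<in> carrier G" "y \<in> carrier G" "x \<noteq> y"
  obtains F :: "nat monoid" and \<phi>
  where "group_hom G F \<phi>" "finite (carrier F)" "\<phi> x \<noteq> \<phi> y"
proof -
  interpret G: group G using assms(1) by (simp add: residually_finite_group_def)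
  have "x \<otimes>\<^bsub>G\<^esub> inv\<^bsub>G\<^esub> y \<noteq> \<one>\<^bsub>G\<^esub>"
    \<comment> \<open>If x y^-1 were the identity, x would be the inverse of y^-1, that is,
      y.\<close>
    using assms(2-4) G.inv_equality[of x "inv\<^bsub>G\<^esub> y"] by auto
  then obtain F :: "nat monoid" and \<phi>
    where F: "group F" "finite (carrier F)" "\<phi> \<in> hom G F"
      and sep: "\<phi> (x \<otimes>\<^bsub>G\<^esub> inv\<^bsub>G\<^esub> y) \<noteq> \<one>\<^bsub>F\<^esub>"
    using assms(1-3) unfolding residually_finite_group_def
    by (metis G.inv_closed G.m_closed)
  interpret group_hom G F \<phi>
    using F G.is_group by (simp add: group_hom_def group_hom_axioms_def)
  have "\<phi> x \<noteq> \<phi> y"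
    using sep assms(2,3) by auto
  then show thesis
    using that F(2) group_hom_axioms by blast
qed

theorem proposition4p1:
  fixes G :: "('a, 'b) monoid_scheme"
  assumes "residually_finite_group G"
  shows "residually_finite_quandle (Conj G) \<and> residually_finite_quandle (Core G)"
proof -
  interpret G: group G using assms by (simp add: residually_finite_group_def)
  have "\<exists>F :: nat quandle_struct. \<exists>\<phi>. quandle F \<and> finite (carrier F) \<and>
          \<phi> \<in> quandle_hom (Conj G) F \<and> \<phi> x \<noteq> \<phi> y"
       "\<exists>F :: nat quandle_struct. \<exists>\<phi>. quandle F \<and> finite (carrier F) \<and>
          \<phi> \<in> quandle_hom (Core G) F \<and> \<phi> x \<noteq> \<phi> y"
    if xy: "x \<in> carrier G" "y \<in> carrier G" "x \<noteq> y" for x y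
  proof -
    obtain F :: "nat monoid" and \<phi>
      where hom: "group_hom G F \<phi>" and "finite (carrier F)" "\<phi> x \<noteq> \<phi> y"
      using residually_finite_group_separates[OF assms xy] by blast
    \<comment> \<open>The targets are \<open>Conj F\<close> and \<open>Core F\<close>, on the same
      finite set of naturals as \<open>F\<close>, with \<open>\<phi>\<close> itself as the
      separating map.\<close>
    moreover have "finite (carrier (Conj F))" "finite (carrier (Core F))"
      using \<open>finite (carrier F)\<close> by (simp_all add: Conj_def Core_def)
    moreover have "group F" using hom by (simp add: group_hom_def)
    ultimately show
      "\<exists>F :: nat quandle_struct. \<exists>\<phi>. quandle F \<and> finite (carrier F) \<and>
          \<phi> \<in> quandle_hom (Conj G) F \<and> \<phi> x \<noteq> \<phi> y"
      "\<exists>F :: nat quandle_struct. \<exists>\<phi>. quandle F \<and> finite (carrier F) \<and>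
          \<phi> \<in> quandle_hom (Core G) F \<and> \<phi> x \<noteq> \<phi> y"
      using group.quandle_Conj group.quandle_Core
        group_hom.quandle_hom_Conj[OF hom] group_hom.quandle_hom_Core[OF hom] by blast+
  qed
  moreover have "carrier (Conj G) = carrier G" "carrier (Core G) = carrier G"
    by (simp_all add: Conj_def Core_def)
  ultimately show ?thesis
    using G.quandle_Conj G.quandle_Core by (simp add: residually_finite_quandle_def)
qed

end
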